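(* Let $l=\{a_i;\ i=1,2,3,\dots\}$ be a sequence of real numbers. If its sequence of partial averages $\mu(l)$ converges and $a_i\le\lim\mu(l)$ for all $i=1,2,3,\dots$ (or, alternatively, $a_i\ge\lim\mu(l)$ for all $i=1,2,3,\dots$), then $l$ is statistically convergent.
   Context: $\mathbb{N}=\{1,2,3,\dots\}$. For $K\subseteq\mathbb{N}$ put $K_n=\{k\in K: k\le n\}$; the asymptotic density of $K$ is $d(K)=\lim_{n\to\infty}\frac1n|K_n|$ whenever the limit exists. A sequence $l=\{a_i\}$ of real numbers is statistically convergent to $a\in\mathbb{R}$ if for every $\varepsilon>0$ the set $\{i\in\mathbb{N}: |a_i-a|\ge\varepsilon\}$ has density $0$; it is statistically convergent if it is statistically convergent to some real number. The sequence of partial averages is $\mu(l)=\{\mu_n;\ n=1,2,3,\dots\}$ with $\mu_n=\frac1n\sum_{i=1}^n a_i$. *)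

theory Defs
  imports Complex_Main
begin

text \<open>
  The natural numbers start at 1 here: a sequence \<open>a\<^sub>1, a\<^sub>2, \<dots>\<close> is a function on \<open>nat\<close> whose
  value at 0 is ignored, and 0 never counts as an element of a set of indices.
\<close>

definition initial_part :: "nat set \<Rightarrow> nat \<Rightarrow> nat set" where
  "initial_part K n = {k \<in> K. 1 \<le> k \<and> k \<le> n}"

text \<open>The density is a relation, since the limit need not exist.\<close>

definition has_density :: "nat set \<Rightarrow> real \<Rightarrow> bool" where
  "has_density K d \<longleftrightarrow> (\<lambda>n. real (card (initial_part K n)) / real n) \<longlonglongrightarrow> d"

definition stat_converges_to :: "(nat \<Rightarrow> real) \<Rightarrow> real \<Rightarrow> bool" where
  "stat_converges_to a L \<longleftrightarrow> (\<forall>\<epsilon>>0. has_density {i. 1 \<le> i \<and> \<bar>a i - L\<bar> \<ge> \<epsilon>} 0)"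

definition stat_convergent :: "(nat \<Rightarrow> real) \<Rightarrow> bool" where
  "stat_convergent a \<longleftrightarrow> (\<exists>L. stat_converges_to a L)"

text \<open>The value at \<open>n = 0\<close> is the junk value 0; it does not affect limits.\<close>

definition partial_avg :: "(nat \<Rightarrow> real) \<Rightarrow> nat \<Rightarrow> real" where
  "partial_avg a n = (\<Sum>i=1..n. a i) / real n"

end

theory Submission
  imports Defs
begin

text \<open>
  Let \<open>L\<close> be the limit of the partial averages. As all terms lie on one side of \<open>L\<close>, the deviations
  \<open>a i - L\<close> have constant sign, so no cancellation occurs when they are averaged: the mean of the
  absolute deviations \<open>\<bar>a i - L\<bar>\<close> equals the absolute deviation of the mean
  (\<open>mean_abs_deviation_one_sided\<close>) and therefore tends to \<open>0\<close>. Markov's inequality bounds the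
  proportion of indices \<open>i \<le> n\<close> with \<open>\<bar>a i - L\<bar> \<ge> \<epsilon>\<close> by \<open>1/\<epsilon>\<close> times this mean, so
  that proportion tends to \<open>0\<close> as well (\<open>stat_converges_to_if_mean_abs_deviation\<close>), and \<open>a\<close>
  converges statistically to \<open>L\<close> itself.
\<close>

text \<open>
  Markov's inequality for the counting measure on \<open>{1..n}\<close>: each counted index contributes at
  least \<open>\<epsilon>\<close> to the sum.
\<close>

lemma card_large_deviations_le:
  fixes a :: "nat \<Rightarrow> real"
  shows "\<epsilon> * real (card (initial_part {i. 1 \<le> i \<and> \<bar>a i - L\<bar> \<ge> \<epsilon>} n)) \<le> (\<Sum>i=1..n. \<bar>a i - L\<bar>)"
proof -
  let ?K = "initial_part {i. 1 \<le> i \<and> \<bar>a i - L\<bar> \<ge> \<epsilon>} n"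
  have sub: "?K \<subseteq> {1..n}"
    by (auto simp: initial_part_def)
  have "\<epsilon> * real (card ?K) = (\<Sum>i\<in>?K. \<epsilon>)"
    by simp
  also have "\<dots> \<le> (\<Sum>i\<in>?K. \<bar>a i - L\<bar>)"
    by (rule sum_mono) (simp add: initial_part_def)
  also have "\<dots> \<le> (\<Sum>i=1..n. \<bar>a i - L\<bar>)"
    by (rule sum_mono2) (use sub in auto)
  finally show ?thesis .
qed

text \<open>
  Strong Cesaro convergence implies statistical convergence: by Markov's inequality the density
  quotient is squeezed between \<open>0\<close> and the mean absolute deviation divided by \<open>\<epsilon>\<close>.
\<close>

lemma stat_converges_to_if_mean_abs_deviation:
  fixes a :: "nat \<Rightarrow> real"
  assumes "partial_avg (\<lambda>i. \<bar>a i - L\<bar>) \<longlonglongrightarrow> 0"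
  shows "stat_converges_to a L"
  unfolding stat_converges_to_def has_density_def
proof (intro allI impI)
  fix \<epsilon> :: real
  assume "\<epsilon> > 0"
  let ?K = "\<lambda>n. initial_part {i. 1 \<le> i \<and> \<bar>a i - L\<bar> \<ge> \<epsilon>} n"
  have bound: "real (card (?K n)) / real n \<le> partial_avg (\<lambda>i. \<bar>a i - L\<bar>) n / \<epsilon>" for n
  proof -
    have "real (card (?K n)) \<le> (\<Sum>i=1..n. \<bar>a i - L\<bar>) / \<epsilon>"
      using card_large_deviations_le[of \<epsilon> a L n] \<open>\<epsilon> > 0\<close> by (simp add: field_simps)
    from divide_right_mono[OF this, of "real n"] show ?thesis
      by (simp add: partial_avg_def mult.commute)
  qed
  have lim: "(\<lambda>n. partial_avg (\<lambda>i. \<bar>a i - L\<bar>) n / \<epsilon>) \<longlonglongrightarrow> 0"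
    using tendsto_divide[OF assms tendsto_const[of \<epsilon>]] \<open>\<epsilon> > 0\<close> by simp
  show "(\<lambda>n. real (card (?K n)) / real n) \<longlonglongrightarrow> 0"
    by (rule tendsto_sandwich[OF _ _ tendsto_const lim]) (use bound in auto)
qed

lemma mean_abs_deviation_one_sided:
  fixes a :: "nat \<Rightarrow> real"
  assumes "(\<forall>i\<ge>1. a i \<le> L) \<or> (\<forall>i\<ge>1. a i \<ge> L)" and "n \<ge> 1"
  shows "partial_avg (\<lambda>i. \<bar>a i - L\<bar>) n = \<bar>partial_avg a n - L\<bar>"
proof -
  have "(\<Sum>i=1..n. \<bar>a i - L\<bar>) = \<bar>\<Sum>i=1..n. a i - L\<bar>"
    using assms(1)
  proof
    assume below: "\<forall>i\<ge>1. a i \<le> L"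
    then have "(\<Sum>i=1..n. a i - L) \<le> 0"
      by (intro sum_nonpos) auto
    moreover have "(\<Sum>i=1..n. \<bar>a i - L\<bar>) = (\<Sum>i=1..n. - (a i - L))"
      using below by (intro sum.cong) auto
    ultimately show ?thesis
      by (simp only: sum_negf abs_of_nonpos)
  next
    assume above: "\<forall>i\<ge>1. a i \<ge> L"
    then have "(\<Sum>i=1..n. a i - L) \<ge> 0"
      by (intro sum_nonneg) auto
    moreover have "(\<Sum>i=1..n. \<bar>a i - L\<bar>) = (\<Sum>i=1..n. a i - L)"
      using above by (intro sum.cong) auto
    ultimately show ?thesis
      by (simp only: abs_of_nonneg)
  qed
  moreover have "partial_avg a n - L = (\<Sum>i=1..n. a i - L) / real n"
    using assms(2) by (simp add: partial_avg_def sum_subtractf field_simps)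
  ultimately show ?thesis
    by (simp add: partial_avg_def)
qed

theorem theorem2p4:
  fixes a :: "nat \<Rightarrow> real"
  assumes "convergent (partial_avg a)"
    and "(\<forall>i\<ge>1. a i \<le> lim (partial_avg a)) \<or> (\<forall>i\<ge>1. a i \<ge> lim (partial_avg a))"
  shows "stat_convergent a"
proof -
  define L where "L = lim (partial_avg a)"
  have one_sided: "(\<forall>i\<ge>1. a i \<le> L) \<or> (\<forall>i\<ge>1. a i \<ge> L)"
    using assms(2) by (simp only: L_def)
  have "partial_avg a \<longlonglongrightarrow> L"
    using assms(1) by (simp add: L_def convergent_LIMSEQ_iff)
  then have "(\<lambda>n. \<bar>partial_avg a n - L\<bar>) \<longlonglongrightarrow> 0"
    by (intro tendsto_rabs_zero) (rule LIM_zero)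
  \<comment> \<open>The two sequences may differ at \<open>0\<close>, where \<open>partial_avg\<close> has the default value \<open>0\<close>.\<close>
  moreover have "\<forall>\<^sub>F n in sequentially. \<bar>partial_avg a n - L\<bar> = partial_avg (\<lambda>i. \<bar>a i - L\<bar>) n"
    using eventually_ge_at_top[of 1]
    by eventually_elim (simp add: mean_abs_deviation_one_sided[OF one_sided])
  ultimately have "partial_avg (\<lambda>i. \<bar>a i - L\<bar>) \<longlonglongrightarrow> 0"
    by (rule Lim_transform_eventually)
  then show ?thesis
    unfolding stat_convergent_def using stat_converges_to_if_mean_abs_deviation by blast
qed

end
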